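(* Let $1\le r,t<\infty$ and $m\in\mathbb N$. Let $f,g\in L^\infty_c(\mathbb R^n)$ and $b\in L^1_{\rm loc}(\mathbb R^n)$. Fix a cube $Q\subset\mathbb R^n$ and for $0\le k\le m$ (integer) define $$c_k:=\big\langle|b-\langle b\rangle_Q|^{m-k}|f|\big\rangle_{r,Q}\,\big\langle|b-\langle b\rangle_Q|^k|g|\big\rangle_{t,Q}.$$ Then $c_k\le c_0+c_m$ for every $0\le k\le m$.
   Context: $L^\infty_c(\mathbb R^n)$ is the set of bounded functions with compact support. $\langle h\rangle_Q:=\frac1{|Q|}\int_Qh$ and, for $h\ge0$ and $r>0$, $\langle h\rangle_{r,Q}:=\big(\frac1{|Q|}\int_Qh^r\big)^{1/r}$. Cubes have sides parallel to the axes. *)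

theory Defs
  imports "HOL-Analysis.Analysis"
begin

(* Essentially bounded functions of compact essential support. Functions stand for their
   classes modulo null sets, so both conditions are imposed almost everywhere. *)
definition Linf_c :: "(real ^ 'n \<Rightarrow> 'a::euclidean_space) set" where
  "Linf_c = {f \<in> borel_measurable lebesgue.
     (\<exists>C. AE x in lebesgue. norm (f x) \<le> C) \<and>
     (\<exists>K. compact K \<and> (AE x in lebesgue. x \<notin> K \<longrightarrow> f x = 0))}"

definition L1_loc :: "(real ^ 'n \<Rightarrow> 'a::euclidean_space) set" where
  "L1_loc = {b \<in> borel_measurable lebesgue. \<forall>K. compact K \<longrightarrow> set_integrable lebesgue K b}"

(* Nondegenerate cubes with sides parallel to the axes. Any part of the boundary may be
   included, so that open, closed and half-open cubes are all covered. *)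
definition is_cube :: "(real ^ 'n) set \<Rightarrow> bool" where
  "is_cube Q \<longleftrightarrow>
     (\<exists>a l. l > 0 \<and> box a (a + (\<chi> i. l)) \<subseteq> Q \<and> Q \<subseteq> cbox a (a + (\<chi> i. l)))"

definition avg :: "(real ^ 'n) set \<Rightarrow> (real ^ 'n \<Rightarrow> 'a::euclidean_space) \<Rightarrow> 'a" where
  "avg Q h = (1 / measure lebesgue Q) *\<^sub>R set_lebesgue_integral lebesgue Q h"

(* Powers in [0, \<infinity>] with exponent p > 0, the only case in use. *)
definition ennpow :: "ennreal \<Rightarrow> real \<Rightarrow> ennreal" where
  "ennpow x p = (if x = \<infinity> then \<infinity> else ennreal (enn2real x powr p))"

(* The r-average of a nonnegative h, with value \<infinity> when h ^ r is not integrable over Q. *)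
definition ravg :: "real \<Rightarrow> (real ^ 'n) set \<Rightarrow> (real ^ 'n \<Rightarrow> real) \<Rightarrow> ennreal" where
  "ravg r Q h =
     ennpow ((\<integral>\<^sup>+ x\<in>Q. ennreal (h x powr r) \<partial>lebesgue) / emeasure lebesgue Q) (1 / r)"

end

theory Submission
  imports Defs
begin

text \<open>
  With \<open>w = |b - \<langle>b\<rangle>\<^sub>Q|\<close> and \<open>\<theta> = k / m\<close>, Hoelder's inequality shows that the norms
  \<open>A\<^sub>j = \<langle>w\<^sup>j |f|\<rangle>\<^bsub>r,Q\<^esub>\<close> and \<open>B\<^sub>j = \<langle>w\<^sup>j |g|\<rangle>\<^bsub>t,Q\<^esub>\<close> are logarithmically convex in \<open>j\<close>, so that
  \<open>c\<^sub>k \<le> (A\<^sub>m B\<^sub>0)\<^bsup>1-\<theta>\<^esup> (A\<^sub>0 B\<^sub>m)\<^bsup>\<theta>\<^esup> = c\<^sub>0\<^bsup>1-\<theta>\<^esup> c\<^sub>m\<^bsup>\<theta>\<^esup> \<le> c\<^sub>0 + c\<^sub>m\<close>.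
  As \<open>f\<close> and \<open>g\<close> are essentially bounded, \<open>A\<^sub>0\<close> and \<open>B\<^sub>0\<close> are finite; hence if \<open>A\<^sub>m\<close> or \<open>B\<^sub>m\<close> is
  infinite, then either the right-hand side is infinite or one of \<open>f\<close>, \<open>g\<close> vanishes a.e. on \<open>Q\<close>.
\<close>

section \<open>Hoelder's inequality for integrals\<close>

lemma weighted_AM_GM:
  fixes a b \<theta> :: real
  assumes "0 \<le> a" "0 \<le> b" "0 < \<theta>" "\<theta> < 1"
  shows "a powr \<theta> * b powr (1 - \<theta>) \<le> \<theta> * a + (1 - \<theta>) * b"
proof (cases "a = 0 \<or> b = 0")
  case False
  then show ?thesis using assms by (intro Youngs_inequality_0) auto
qed (use assms in auto)

text \<open>The integrand vanishes wherever \<open>u\<close> does, since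
  \<open>0 powr \<alpha> = 0\<close> for every \<alpha>. The integral of \<open>v\<close> may be
  infinite, a case that Hoelder's inequality below does not cover.\<close>

lemma nn_integral_powr_product_eq_0:
  fixes u v :: "'a \<Rightarrow> real"
  assumes [measurable]: "u \<in> borel_measurable M" "v \<in> borel_measurable M"
    and nonneg: "\<And>x. 0 \<le> u x"
    and zero: "(\<integral>\<^sup>+x. ennreal (u x) \<partial>M) = 0"
  shows "(\<integral>\<^sup>+x. ennreal (u x powr \<alpha> * v x powr \<beta>) \<partial>M) = 0"
proof -
  have "AE x in M. u x = 0"
    using zero nonneg by (subst (asm) nn_integral_0_iff_AE) (auto simp: ennreal_eq_0_iff antisym)
  then show ?thesis
    by (subst nn_integral_0_iff_AE) auto
qed

lemma nn_integral_Holder: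
  fixes u v :: "'a \<Rightarrow> real"
  assumes [measurable]: "u \<in> borel_measurable M" "v \<in> borel_measurable M"
    and nonneg: "\<And>x. 0 \<le> u x" "\<And>x. 0 \<le> v x"
    and U: "(\<integral>\<^sup>+x. ennreal (u x) \<partial>M) = ennreal U" "0 \<le> U"
    and V: "(\<integral>\<^sup>+x. ennreal (v x) \<partial>M) = ennreal V" "0 \<le> V"
    and \<theta>: "0 < \<theta>" "\<theta> < 1"
  shows "(\<integral>\<^sup>+x. ennreal (u x powr \<theta> * v x powr (1 - \<theta>)) \<partial>M)
    \<le> ennreal (U powr \<theta> * V powr (1 - \<theta>))"
proof -
  consider "U = 0" | "V = 0" | "0 < U" "0 < V" using U V by linarith
  then show ?thesis
  proof cases
    case 1
    then show ?thesis
      using nn_integral_powr_product_eq_0[of u M v \<theta> "1 - \<theta>"] nonneg U by simp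
  next
    case 2
    then show ?thesis
      using nn_integral_powr_product_eq_0[of v M u "1 - \<theta>" \<theta>] nonneg V by (simp add: mult.commute)
  next
    case 3
    \<comment> \<open>\<open>P\<close> is the bound to be proved. Factoring it out normalises both
      functions to integral 1; weighted AM-GM for \<open>u x / U\<close> and \<open>v x / V\<close>
      then integrates to \<open>P * (\<theta> + (1 - \<theta>)) = P\<close>.\<close>
    define P where "P = U powr \<theta> * V powr (1 - \<theta>)"
    have P: "0 < P" using 3 by (simp add: P_def)
    have young: "u x powr \<theta> * v x powr (1 - \<theta>)
        \<le> (P * \<theta> / U) * u x + (P * (1 - \<theta>) / V) * v x" for x
    proof -
      have "u x powr \<theta> * v x powr (1 - \<theta>) = P * ((u x / U) powr \<theta> * (v x / V) powr (1 - \<theta>))"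
        using 3 nonneg by (simp add: P_def powr_divide)
      also have "\<dots> \<le> P * (\<theta> * (u x / U) + (1 - \<theta>) * (v x / V))"
        using 3 nonneg \<theta> P by (intro mult_left_mono weighted_AM_GM) auto
      finally show ?thesis by (simp add: algebra_simps)
    qed
    have "(\<integral>\<^sup>+x. ennreal (u x powr \<theta> * v x powr (1 - \<theta>)) \<partial>M)
        \<le> (\<integral>\<^sup>+x. ennreal (P * \<theta> / U) * ennreal (u x) + ennreal (P * (1 - \<theta>) / V) * ennreal (v x) \<partial>M)"
      using young P 3 \<theta> nonneg
      by (intro nn_integral_mono) (simp flip: ennreal_mult ennreal_plus)
    also have "\<dots> = ennreal (P * \<theta> / U) * ennreal U + ennreal (P * (1 - \<theta>) / V) * ennreal V"
      by (simp add: nn_integral_add nn_integral_cmult U V)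
    also have "\<dots> = ennreal P"
      using 3 P \<theta> by (simp add: field_simps flip: ennreal_mult ennreal_plus)
    finally show ?thesis by (simp add: P_def)
  qed
qed

section \<open>Averages with values in [0, \<infinity>]\<close>

lemma ennpow_ennreal: "0 \<le> a \<Longrightarrow> ennpow (ennreal a) p = ennreal (a powr p)"
  by (simp add: ennpow_def)

lemma ennpow_eq_0_iff [simp]: "ennpow x p = 0 \<longleftrightarrow> x = 0"
  by (cases x) (auto simp: ennpow_def ennreal_eq_0_iff)

lemma ennpow_less_top: "x < top \<Longrightarrow> ennpow x p < top"
  by (simp add: ennpow_def)

lemma ennpow_mono:
  assumes "x \<le> y" "0 \<le> p"
  shows "ennpow x p \<le> ennpow y p"
  using assms by (cases x; cases y) (auto simp: ennpow_def top_unique intro!: ennreal_leI powr_mono2)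

lemma ennpow_inverse:
  assumes "ennpow x (1 / p) = ennreal a" "0 < p" "0 \<le> a"
  shows "x = ennreal (a powr p)"
  using assms by (cases x) (auto simp: ennpow_def powr_powr)

text \<open>Absorbing the factor 1/|Q| into the measure turns the average into a plain integral, to
  which the results for general measures apply.\<close>

lemma ravg_uniform_measure:
  assumes "h \<in> borel_measurable lebesgue" "Q \<in> sets lebesgue"
  shows "ravg r Q h = ennpow (\<integral>\<^sup>+x. ennreal (h x powr r) \<partial>uniform_measure lebesgue Q) (1 / r)"
  using assms by (simp add: ravg_def nn_integral_uniform_measure)

lemma ravg_powr_product_eq_0:
  assumes [measurable]: "u \<in> borel_measurable lebesgue" "v \<in> borel_measurable lebesgue"
      "Q \<in> sets lebesgue"
    and nonneg: "\<And>x. 0 \<le> u x" "\<And>x. 0 \<le> v x"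
    and "ravg r Q u = 0"
  shows "ravg r Q (\<lambda>x. u x powr \<alpha> * v x powr \<beta>) = 0"
proof -
  have "(\<integral>\<^sup>+x. ennreal (u x powr r) \<partial>uniform_measure lebesgue Q) = 0"
    using assms by (simp add: ravg_uniform_measure)
  then have "(\<integral>\<^sup>+x. ennreal ((u x powr r) powr \<alpha> * (v x powr r) powr \<beta>) \<partial>uniform_measure lebesgue Q) = 0"
    by (intro nn_integral_powr_product_eq_0) auto
  then show ?thesis
    using nonneg by (simp add: ravg_uniform_measure powr_mult powr_powr mult.commute)
qed

text \<open>Hoelder's inequality for \<open>u powr r\<close> and \<open>v powr r\<close>, followed
  by an r-th root.\<close>

lemma ravg_Holder:
  assumes [measurable]: "u \<in> borel_measurable lebesgue" "v \<in> borel_measurable lebesgue"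
      "Q \<in> sets lebesgue"
    and nonneg: "\<And>x. 0 \<le> u x" "\<And>x. 0 \<le> v x"
    and U: "ravg r Q u = ennreal U" "0 \<le> U"
    and V: "ravg r Q v = ennreal V" "0 \<le> V"
    and \<theta>: "0 < \<theta>" "\<theta> < 1" and r: "0 < r"
  shows "ravg r Q (\<lambda>x. u x powr \<theta> * v x powr (1 - \<theta>)) \<le> ennreal (U powr \<theta> * V powr (1 - \<theta>))"
proof -
  let ?N = "uniform_measure lebesgue Q"
  have "(\<integral>\<^sup>+x. ennreal (u x powr r) \<partial>?N) = ennreal (U powr r)"
    using U r by (intro ennpow_inverse) (auto simp: ravg_uniform_measure)
  moreover have "(\<integral>\<^sup>+x. ennreal (v x powr r) \<partial>?N) = ennreal (V powr r)"
    using V r by (intro ennpow_inverse) (auto simp: ravg_uniform_measure)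
  ultimately have "(\<integral>\<^sup>+x. ennreal ((u x powr r) powr \<theta> * (v x powr r) powr (1 - \<theta>)) \<partial>?N)
      \<le> ennreal ((U powr r) powr \<theta> * (V powr r) powr (1 - \<theta>))"
    using \<theta> by (intro nn_integral_Holder) auto
  then have "(\<integral>\<^sup>+x. ennreal ((u x powr \<theta> * v x powr (1 - \<theta>)) powr r) \<partial>?N)
      \<le> ennreal ((U powr \<theta> * V powr (1 - \<theta>)) powr r)"
    using nonneg U V by (simp add: powr_mult powr_powr mult.commute)
  from ennpow_mono[OF this, of "1 / r"] show ?thesis
    using r U V by (simp add: ravg_uniform_measure ennpow_ennreal powr_powr)
qed

section \<open>Cubes and averages of bounded functions\<close>

lemma cube_lebesgue:
  fixes Q :: "(real ^ 'n) set"
  assumes "is_cube Q"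
  shows "Q \<in> sets lebesgue" "0 < emeasure lebesgue Q" "emeasure lebesgue Q < \<infinity>"
proof -
  from assms obtain a :: "real ^ 'n" and l :: real where l: "l > 0"
    and sub: "box a (a + (\<chi> i. l)) \<subseteq> Q" "Q \<subseteq> cbox a (a + (\<chi> i. l))"
    unfolding is_cube_def by blast
  let ?c = "a + (\<chi> i. l)"
  \<comment> \<open>\<open>Q\<close> is the open box together with a subset of its frontier. The
    frontier is a null set, so this subset is measurable by completeness of Lebesgue
    measure.\<close>
  have "negligible (Q - box a ?c)"
    using sub by (intro negligible_subset[OF negligible_frontier_interval[of a ?c]]) auto
  then have "Q - box a ?c \<in> sets lebesgue"
    by (simp add: negligible_iff_null_sets null_setsD2)
  then have "box a ?c \<union> (Q - box a ?c) \<in> sets lebesgue"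
    by (intro sets.Un) auto
  then show Q: "Q \<in> sets lebesgue"
    using sub by (simp add: Un_absorb1)
  have "box a ?c \<noteq> {}"
    using l by (simp add: interval_ne_empty_cart)
  then have "0 < emeasure lebesgue (box a ?c)"
    by (metis negligible_interval(2) negligible_iff_null_sets null_setsI not_gr_zero
        lebesgue_on_UNIV_eq lmeasurable_box fmeasurableD)
  also have "\<dots> \<le> emeasure lebesgue Q"
    using sub Q by (intro emeasure_mono)
  finally show "0 < emeasure lebesgue Q" .
  have "emeasure lebesgue Q \<le> emeasure lebesgue (cbox a ?c)"
    using sub by (intro emeasure_mono) auto
  also have "\<dots> < \<infinity>"
    by (simp add: emeasure_lborel_cbox_eq)
  finally show "emeasure lebesgue Q < \<infinity>" .
qed

lemma ravg_bounded_less_top: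
  assumes [measurable]: "h \<in> borel_measurable lebesgue"
    and nonneg: "\<And>x. 0 \<le> h x" and bound: "AE x in lebesgue. h x \<le> C"
    and Q: "Q \<in> sets lebesgue" "0 < emeasure lebesgue Q" "emeasure lebesgue Q < \<infinity>"
    and r: "0 < r"
  shows "ravg r Q h < top"
proof -
  have ae: "AE x in uniform_measure lebesgue Q. h x \<le> C"
    using bound Q by (intro AE_uniform_measureI) auto
  have "(\<integral>\<^sup>+x. ennreal (h x powr r) \<partial>uniform_measure lebesgue Q)
      \<le> (\<integral>\<^sup>+x. ennreal (C powr r) \<partial>uniform_measure lebesgue Q)"
    using ae nonneg r by (intro nn_integral_mono_AE) (auto intro!: ennreal_leI powr_mono2)
  also have "\<dots> = ennreal (C powr r)"
    using Q emeasure_uniform_measure_1[of lebesgue Q]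
    by (simp add: nn_integral_uniform_measure ennreal_mult_divide_eq)
  also have "\<dots> < top" by simp
  finally show ?thesis
    using Q by (simp add: ravg_uniform_measure ennpow_less_top)
qed

section \<open>Interpolation between the endpoint norms\<close>

text \<open>Splitting \<open>z\<close> into powers with exponents j/m and 1 - j/m puts the integrand
  into the form required by Hoelder's inequality. For \<open>j = 0\<close> the identity would fail
  at \<open>w = 0 < z\<close>, where \<open>0 powr 0 = 0\<close> but
  \<open>w ^ 0 = 1\<close>.\<close>

lemma power_times_eq_powr_interpolation:
  fixes w z :: real
  assumes "0 \<le> w" "0 \<le> z" "0 < j" "j < m"
  shows "w ^ j * z = (w ^ m * z) powr (real j / real m) * z powr (1 - real j / real m)"
proof (cases "w = 0 \<or> z = 0")
  case True
  then show ?thesis using assms by (auto simp: power_0_left)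
next
  case False
  then have "(w ^ m * z) powr (real j / real m) = w ^ j * z powr (real j / real m)"
    using assms by (simp add: powr_mult powr_powr flip: powr_realpow)
  then show ?thesis
    using False assms by (simp add: mult.assoc flip: powr_add)
qed

lemma ennreal_interpolated_product_le_add:
  fixes A B A0 Am B0 Bm :: ennreal and \<theta> :: real
  assumes \<theta>: "0 < \<theta>" "\<theta> < 1"
    and fin: "A0 < top" "B0 < top"
    and zero: "A0 = 0 \<Longrightarrow> A = 0" "B0 = 0 \<Longrightarrow> B = 0"
    and A: "\<And>x y. \<lbrakk>Am = ennreal x; A0 = ennreal y; 0 \<le> x; 0 \<le> y\<rbrakk>
      \<Longrightarrow> A \<le> ennreal (x powr (1 - \<theta>) * y powr \<theta>)"
    and B: "\<And>x y. \<lbrakk>Bm = ennreal x; B0 = ennreal y; 0 \<le> x; 0 \<le> y\<rbrakk>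
      \<Longrightarrow> B \<le> ennreal (x powr \<theta> * y powr (1 - \<theta>))"
  shows "A * B \<le> Am * B0 + A0 * Bm"
proof -
  \<comment> \<open>In \<open>ennreal\<close>, \<open>0 * top = 0\<close>. An infinite
    \<open>Am\<close> or \<open>Bm\<close> therefore forces the right-hand side to be infinite only
    after vanishing \<open>A0\<close> or \<open>B0\<close> has been split off.\<close>
  consider "A0 = 0 \<or> B0 = 0" | "A0 \<noteq> 0" "B0 \<noteq> 0" "Am = top \<or> Bm = top"
    | "Am < top" "Bm < top"
    by (metis less_top)
  then show ?thesis
  proof cases
    case 1
    then show ?thesis using zero by auto
  next
    case 2
    then show ?thesis by (auto simp: ennreal_mult_top ennreal_top_mult)
  next
    case 3
    obtain am where am: "Am = ennreal am" "0 \<le> am" using 3 by (cases Am) auto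
    obtain bm where bm: "Bm = ennreal bm" "0 \<le> bm" using 3 by (cases Bm) auto
    obtain a0 where a0: "A0 = ennreal a0" "0 \<le> a0" using fin by (cases A0) auto
    obtain b0 where b0: "B0 = ennreal b0" "0 \<le> b0" using fin by (cases B0) auto
    have "A * B \<le> ennreal (am powr (1 - \<theta>) * a0 powr \<theta>) * ennreal (bm powr \<theta> * b0 powr (1 - \<theta>))"
      using A B am bm a0 b0 by (intro mult_mono) auto
    \<comment> \<open>The exponents match crosswise: \<open>a0\<close> and \<open>bm\<close> carry
      \<theta>, \<open>am\<close> and \<open>b0\<close> carry 1 - \<theta>, so the two products on
      the right-hand side reappear.\<close>
    also have "\<dots> = ennreal ((a0 * bm) powr \<theta> * (am * b0) powr (1 - \<theta>))"
      using am bm a0 b0 by (simp add: powr_mult mult_ac flip: ennreal_mult)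
    also have "\<dots> \<le> ennreal (\<theta> * (a0 * bm) + (1 - \<theta>) * (am * b0))"
      using am bm a0 b0 \<theta> by (intro ennreal_leI weighted_AM_GM) auto
    also have "\<dots> \<le> ennreal (am * b0 + a0 * bm)"
      using am bm a0 b0 \<theta> mult_right_mono[of \<theta> 1 "a0 * bm"] mult_right_mono[of "1 - \<theta>" 1 "am * b0"]
      by (intro ennreal_leI) simp
    also have "\<dots> = Am * B0 + A0 * Bm"
      using am bm a0 b0 by (simp add: ennreal_mult)
    finally show ?thesis .
  qed
qed

theorem lemma3p4:
  fixes r t :: real and m :: nat
    and f g b :: "real ^ 'n \<Rightarrow> 'a::{real_normed_field, euclidean_space}"
    and Q :: "(real ^ 'n) set" and c :: "nat \<Rightarrow> ennreal"
  assumes "1 \<le> r" and "1 \<le> t"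
    and "f \<in> Linf_c" and "g \<in> Linf_c" and "b \<in> L1_loc"
    and "is_cube Q"
    and "\<And>k. k \<le> m \<Longrightarrow>
      c k = ravg r Q (\<lambda>x. norm (b x - avg Q b) ^ (m - k) * norm (f x)) *
            ravg t Q (\<lambda>x. norm (b x - avg Q b) ^ k * norm (g x))"
  shows "\<forall>k\<le>m. c k \<le> c 0 + c m"
proof (intro allI impI)
  fix k assume "k \<le> m"
  note Q = cube_lebesgue[OF \<open>is_cube Q\<close>]
  have [measurable]: "f \<in> borel_measurable lebesgue" "g \<in> borel_measurable lebesgue"
      "b \<in> borel_measurable lebesgue" "Q \<in> sets lebesgue"
    using assms Q by (auto simp: Linf_c_def L1_loc_def)
  define w where "w x = norm (b x - avg Q b)" for x
  have [measurable]: "w \<in> borel_measurable lebesgue"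
    unfolding w_def by measurable
  have w: "0 \<le> w x" for x by (simp add: w_def)
  have c: "c j = ravg r Q (\<lambda>x. w x ^ (m - j) * norm (f x)) * ravg t Q (\<lambda>x. w x ^ j * norm (g x))"
    if "j \<le> m" for j
    using assms(7)[OF that] by (simp add: w_def)
  have finite: "ravg p Q (\<lambda>x. norm (h x)) < top"
    if p: "1 \<le> p" and h: "h \<in> Linf_c" for p and h :: "real ^ 'n \<Rightarrow> 'a"
  proof -
    obtain C where "AE x in lebesgue. norm (h x) \<le> C" "h \<in> borel_measurable lebesgue"
      using h unfolding Linf_c_def by blast
    then show ?thesis
      using p Q by (intro ravg_bounded_less_top[where C = C]) auto
  qed
  have zero: "ravg p Q (\<lambda>x. w x ^ j * norm (h x)) = 0"
    if "0 < j" "j < m" "ravg p Q (\<lambda>x. norm (h x)) = 0" and [measurable]: "h \<in> borel_measurable lebesgue"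
    for p j and h :: "real ^ 'n \<Rightarrow> 'a"
    \<comment> \<open>The vanishing factor is \<open>norm (h x)\<close>; the average of
      \<open>w x ^ m * norm (h x)\<close> may be infinite.\<close>
    using ravg_powr_product_eq_0[of "\<lambda>x. norm (h x)" "\<lambda>x. w x ^ m * norm (h x)" Q p
        "1 - real j / real m" "real j / real m"] that w
    by (simp add: power_times_eq_powr_interpolation[where j = j and m = m]
        mult.commute[of "(w _ ^ m * norm (h _)) powr _"])
  have interpolate: "ravg p Q (\<lambda>x. w x ^ j * norm (h x))
      \<le> ennreal (x powr (real j / real m) * y powr (1 - real j / real m))"
    if "0 < j" "j < m" "1 \<le> p" and [measurable]: "h \<in> borel_measurable lebesgue"
      and "ravg p Q (\<lambda>x. w x ^ m * norm (h x)) = ennreal x" "0 \<le> x"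
      and "ravg p Q (\<lambda>x. norm (h x)) = ennreal y" "0 \<le> y"
    for p j x y and h :: "real ^ 'n \<Rightarrow> 'a"
    using ravg_Holder[of "\<lambda>x. w x ^ m * norm (h x)" "\<lambda>x. norm (h x)" Q p x y "real j / real m"] that w
    by (simp add: power_times_eq_powr_interpolation[where j = j and m = m])
  \<comment> \<open>At the endpoints \<open>c k\<close> is itself one of the two summands;
    interpolation is needed only strictly in between.\<close>
  consider "k = 0" | "k = m" | "0 < k" "k < m" using \<open>k \<le> m\<close> by linarith
  then show "c k \<le> c 0 + c m"
  proof cases
    case 3
    define \<theta> where "\<theta> = real k / real m"
    have \<theta>: "0 < \<theta>" "\<theta> < 1" "real (m - k) / real m = 1 - \<theta>"
      using 3 by (auto simp: \<theta>_def of_nat_diff field_simps)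
    have "ravg r Q (\<lambda>x. w x ^ (m - k) * norm (f x)) * ravg t Q (\<lambda>x. w x ^ k * norm (g x))
      \<le> ravg r Q (\<lambda>x. w x ^ m * norm (f x)) * ravg t Q (\<lambda>x. norm (g x))
        + ravg r Q (\<lambda>x. norm (f x)) * ravg t Q (\<lambda>x. w x ^ m * norm (g x))"
    proof (rule ennreal_interpolated_product_le_add[OF \<theta>(1,2)])
      \<comment> \<open>The weight of \<open>f\<close> has power m - k, hence exponent (m - k)/m = 1
        - \<theta>; this is why \<theta> and 1 - \<theta> trade places between \<open>f\<close> and
        \<open>g\<close>.\<close>
      show "ravg r Q (\<lambda>x. w x ^ (m - k) * norm (f x)) \<le> ennreal (x powr (1 - \<theta>) * y powr \<theta>)"
        if "ravg r Q (\<lambda>x. w x ^ m * norm (f x)) = ennreal x" "ravg r Q (\<lambda>x. norm (f x)) = ennreal y"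
          "0 \<le> x" "0 \<le> y" for x y
        using interpolate[of "m - k" r f x y] that 3 assms \<theta> by simp
      show "ravg t Q (\<lambda>x. w x ^ k * norm (g x)) \<le> ennreal (x powr \<theta> * y powr (1 - \<theta>))"
        if "ravg t Q (\<lambda>x. w x ^ m * norm (g x)) = ennreal x" "ravg t Q (\<lambda>x. norm (g x)) = ennreal y"
          "0 \<le> x" "0 \<le> y" for x y
        using interpolate[of k t g x y] that 3 assms by (simp add: \<theta>_def)
    qed (use assms 3 in \<open>auto intro!: finite zero\<close>)
    then show ?thesis by (simp add: c \<open>k \<le> m\<close>)
  qed auto
qed

end
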